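(* If $\sigma:=\ell\cdot\deg_t(v)>(2n-1)\deg_t(f)$, then $L'=W$, where $L'\subseteq\mathbb{F}_p^{\,r}$ is the intersection of the kernels of the matrices $\tilde A_0,\dots,\tilde A_{n-1}$.
   Context: Let $q=p^w$, $K=\mathbb{F}_q(t)$, $\mathcal{O}=\mathbb{F}_q[t]$. Let $f\in\mathbb{F}_q[t][X]$ be separable of $X$-degree $n\ge2$ with leading coefficient $\ell_f$. Let $v\in\mathbb{F}_q[t]$ be irreducible with $v\nmid\ell_f$ and such that the image of $f$ in $k[X]$, $k=\mathbb{F}_q[t]/(v)$, is squarefree. Let $\mathcal{O}_v$ be the $v$-adic completion of $\mathbb{F}_q[t]$. Write $f=\ell_f f_1\cdots f_r$ with $f_i\in\mathcal{O}_v[X]$ monic irreducible, and $f=\ell_f g_1\cdots g_s$ with $g_j\in\mathbb{F}_q(t)[X]$ monic irreducible; $g_j=f_1^{w_{j,1}}\cdots f_r^{w_{j,r}}$ with $w_{j,i}\in\{0,1\}$; $W\subseteq\mathbb{F}_p^{\,r}$ is the $\mathbb{F}_p$-span of the vectors $(w_{j,1},\dots,w_{j,r})^T$. Fix $\ell\ge1$ and $\sigma=\ell\deg_t v$. For $a\in\mathcal{O}_v$, "$a$ mod $v^\ell$" is the unique element of $\mathbb{F}_q[t]$ of degree $<\sigma$ congruent to $a$ modulo $v^\ell$ (extended coefficientwise to polynomials). Let $\Phi(f_j)=ff_j'/f_j\in\mathcal{O}_v[X]$ and write $\Phi(f_j)\bmod v^\ell=\sum_{i=0}^{n-1}a_{i,j}X^i$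 with $a_{i,j}\in\mathbb{F}_q[t]$. Put $m=\deg_t(f)+1$ and $\phi_m(\sum_kc_kt^k)=(c_m,\dots,c_{\sigma-1})^T\in\mathbb{F}_q^{\sigma-m}$. Let $A_i$ be the $(\sigma-m)\times r$ matrix over $\mathbb{F}_q$ with columns $\phi_m(a_{i,1}),\dots,\phi_m(a_{i,r})$. Fix an $\mathbb{F}_p$-basis $\gamma_1,\dots,\gamma_w$ of $\mathbb{F}_q$ and let $\psi:\mathbb{F}_q\to\mathbb{F}_p^{\,w}$, $\sum c_l\gamma_l\mapsto(c_1,\dots,c_w)^T$. $\tilde A_i$ is the $w(\sigma-m)\times r$ matrix over $\mathbb{F}_p$ obtained by replacing each entry $c$ of $A_i$ by the column $\psi(c)$. *)

theory Defs
  imports "HOL-Computational_Algebra.Computational_Algebra"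
begin

text \<open>Setting: 'a is the finite field F_q; 'a poly is F_q[t]; 'a poly poly is F_q[t][X]
  (outer variable X, coefficients in F_q[t]); 'a poly fract poly is K[X] with K = F_q(t).\<close>

definition redX :: "'a::field poly \<Rightarrow> nat \<Rightarrow> 'a poly poly \<Rightarrow> 'a poly poly" where
  "redX v k P = map_poly (\<lambda>c. c mod v ^ k) P"

text \<open>The v-adic completion O_v is modelled as the inverse limit of F_q[t]/(v^k):
  an element is a compatible sequence of reduced residues (component k = element mod v^k).
  A polynomial over O_v (element of O_v[X]) is a compatible sequence of polynomials
  P k in F_q[t][X] reduced mod v^k, of bounded X-degree.\<close>
definition OvX_elem :: "'a::field poly \<Rightarrow> (nat \<Rightarrow> 'a poly poly) \<Rightarrow> bool" where
  "OvX_elem v P \<longleftrightarrow> (\<forall>k. P k = redX v k (P (Suc k))) \<and> (\<exists>d. \<forall>k. degree (P k) \<le> d)"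

definition embX :: "'a::field poly \<Rightarrow> 'a poly poly \<Rightarrow> nat \<Rightarrow> 'a poly poly" where
  "embX v f = (\<lambda>k. redX v k f)"

definition mulOv :: "'a::field poly \<Rightarrow> (nat \<Rightarrow> 'a poly poly) \<Rightarrow> (nat \<Rightarrow> 'a poly poly) \<Rightarrow> nat \<Rightarrow> 'a poly poly" where
  "mulOv v P Q = (\<lambda>k. redX v k (P k * Q k))"

definition derOv :: "'a::field poly \<Rightarrow> (nat \<Rightarrow> 'a poly poly) \<Rightarrow> nat \<Rightarrow> 'a poly poly" where
  "derOv v P = (\<lambda>k. redX v k (pderiv (P k)))"

definition OvX_unit :: "'a::field poly \<Rightarrow> (nat \<Rightarrow> 'a poly poly) \<Rightarrow> bool" where
  "OvX_unit v P \<longleftrightarrow> OvX_elem v P \<and> (\<exists>Q. OvX_elem v Q \<and> mulOv v P Q = embX v 1)"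

definition OvX_irreducible :: "'a::field poly \<Rightarrow> (nat \<Rightarrow> 'a poly poly) \<Rightarrow> bool" where
  "OvX_irreducible v P \<longleftrightarrow> OvX_elem v P \<and> P \<noteq> embX v 0 \<and> \<not> OvX_unit v P \<and>
     (\<forall>A B. OvX_elem v A \<and> OvX_elem v B \<and> P = mulOv v A B \<longrightarrow> OvX_unit v A \<or> OvX_unit v B)"

definition OvX_monic :: "'a::field poly \<Rightarrow> (nat \<Rightarrow> 'a poly poly) \<Rightarrow> bool" where
  "OvX_monic v P \<longleftrightarrow> (\<exists>d. \<forall>k>0. degree (P k) = d \<and> coeff (P k) d = 1)"

definition PhiOv :: "'a::field poly \<Rightarrow> 'a poly poly \<Rightarrow> (nat \<Rightarrow> 'a poly poly) \<Rightarrow> nat \<Rightarrow> 'a poly poly" where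
  "PhiOv v f Fj = (THE H. OvX_elem v H \<and> mulOv v Fj H = mulOv v (embX v f) (derOv v Fj))"

text \<open>v-adic image mod v^k of a v-integral element of F_q(t).\<close>
definition vfrac :: "'a::field poly \<Rightarrow> nat \<Rightarrow> 'a poly fract \<Rightarrow> 'a poly" where
  "vfrac v k x = (THE r. r mod v ^ k = r \<and>
      (\<exists>a b. x = Fract a b \<and> \<not> v dvd b \<and> (r * b) mod v ^ k = a mod v ^ k))"

definition vredX :: "'a::field poly \<Rightarrow> nat \<Rightarrow> 'a poly fract poly \<Rightarrow> 'a poly poly" where
  "vredX v k G = map_poly (vfrac v k) G"

definition squarefree_mod :: "'a::field poly \<Rightarrow> 'a poly poly \<Rightarrow> bool" where
  "squarefree_mod v P \<longleftrightarrow>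
     (\<forall>Q R. redX v 1 P = redX v 1 (Q * Q * R) \<longrightarrow> (\<exists>U. redX v 1 (Q * U) = 1))"

definition separable_K :: "'a::field poly poly \<Rightarrow> bool" where
  "separable_K f \<longleftrightarrow> coprime (map_poly to_fract f) (pderiv (map_poly to_fract f))"

definition degt :: "'a::zero poly poly \<Rightarrow> nat" where
  "degt f = Max (insert 0 (degree ` set (coeffs f)))"

definition Fp :: "'a::field set" where
  "Fp = range of_nat"

definition is_Fp_basis :: "(nat \<Rightarrow> 'a::field) \<Rightarrow> nat \<Rightarrow> bool" where
  "is_Fp_basis \<gamma> w \<longleftrightarrow> (\<forall>c. \<exists>!cs. (\<forall>l. cs l \<in> Fp) \<and> (\<forall>l\<ge>w. cs l = 0) \<and> c = (\<Sum>l<w. cs l * \<gamma> l))"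

definition psi :: "(nat \<Rightarrow> 'a::field) \<Rightarrow> nat \<Rightarrow> 'a \<Rightarrow> nat \<Rightarrow> 'a" where
  "psi \<gamma> w c = (THE cs. (\<forall>l. cs l \<in> Fp) \<and> (\<forall>l\<ge>w. cs l = 0) \<and> c = (\<Sum>l<w. cs l * \<gamma> l))"

end

theory Submission
  imports "Subresultants.Subresultant_Gcd" "Berlekamp_Zassenhaus.Unique_Factorization_Poly" Defs
begin

text \<open>Put \<open>H = \<Sum> x\<^sub>j \<Phi>(f\<^sub>j)\<close>, reduced modulo \<open>v\<^sup>\<ell>\<close>; membership of \<open>x\<close> in \<open>L'\<close> means
  \<open>deg\<^sub>t H \<le> deg\<^sub>t f\<close>. By squarefreeness modulo \<open>v\<close> and a degree count, the global factors \<open>g\<^sub>j\<close> partition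
  the local ones into blocks, and \<open>W\<close> consists of the vectors that are constant on each block.
  If \<open>x\<close> is such a vector, then \<open>H\<close> is a combination of the polynomials \<open>f g\<^sub>j' / g\<^sub>j\<close>, whose \<open>t\<close>-degree is
  at most \<open>deg\<^sub>t f\<close>. Conversely, let \<open>f\<^sub>i\<close> divide \<open>g\<^sub>j\<close>. As \<open>H \<equiv> x\<^sub>i f'\<close> modulo \<open>f\<^sub>i\<close>, the resultant of \<open>g\<^sub>j\<close> and
  \<open>H - x\<^sub>i f'\<close> is divisible by \<open>v\<^sup>\<ell>\<close>; it has \<open>t\<close>-degree at most \<open>(2n-1) deg\<^sub>t f\<close>, hence vanishes, and \<open>g\<^sub>j\<close>
  divides \<open>H - x\<^sub>i f'\<close>. Two indices of the block with different \<open>x\<^sub>i\<close> would make \<open>g\<^sub>j\<close> a divisor of \<open>f'\<close>,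
  against separability.\<close>

section \<open>Congruence of polynomials modulo a constant\<close>

text \<open>Divisibility by a constant polynomial makes the ring laws immediate and spares the
  choice of residues; \<open>redX_eq_iff\<close> ties it to equality of reductions.\<close>

definition polycong :: "'b::idom \<Rightarrow> 'b poly \<Rightarrow> 'b poly \<Rightarrow> bool" where
  "polycong m P Q \<longleftrightarrow> [:m:] dvd P - Q"

lemma polycong_coeff: "polycong m P Q \<longleftrightarrow> (\<forall>i. m dvd coeff P i - coeff Q i)"
  by (simp add: polycong_def const_poly_dvd_iff)

lemma polycong_refl [simp]: "polycong m P P"
  by (simp add: polycong_def)

lemma polycong_sym: "polycong m P Q \<Longrightarrow> polycong m Q P"
  unfolding polycong_def by (metis dvd_minus_iff minus_diff_eq)

lemma polycong_trans [trans]: "polycong m P Q \<Longrightarrow> polycong m Q R \<Longrightarrow> polycong m P R"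
  unfolding polycong_def using dvd_add[of "[:m:]" "P - Q" "Q - R"] by simp

lemma polycong_add: "polycong m P P' \<Longrightarrow> polycong m Q Q' \<Longrightarrow> polycong m (P + Q) (P' + Q')"
  unfolding polycong_def using dvd_add[of "[:m:]" "P - P'" "Q - Q'"] by (simp add: algebra_simps)

lemma polycong_diff: "polycong m P P' \<Longrightarrow> polycong m Q Q' \<Longrightarrow> polycong m (P - Q) (P' - Q')"
  unfolding polycong_def using dvd_diff[of "[:m:]" "P - P'" "Q - Q'"] by (simp add: algebra_simps)

lemma polycong_mult:
  assumes "polycong m P P'" "polycong m Q Q'"
  shows "polycong m (P * Q) (P' * Q')"
proof -
  have "P * Q - P' * Q' = (P - P') * Q + P' * (Q - Q')"
    by (simp add: algebra_simps)
  with assms show ?thesis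
    by (auto simp: polycong_def)
qed

lemma polycong_smult: "polycong m P Q \<Longrightarrow> polycong m (smult c P) (smult c Q)"
  using polycong_mult[of m "[:c:]" "[:c:]" P Q] by simp

lemma polycong_sum: "(\<And>i. i \<in> A \<Longrightarrow> polycong m (P i) (Q i)) \<Longrightarrow> polycong m (\<Sum>i\<in>A. P i) (\<Sum>i\<in>A. Q i)"
  by (induction A rule: infinite_finite_induct) (auto intro: polycong_add)

lemma polycong_prod: "(\<And>i. i \<in> A \<Longrightarrow> polycong m (P i) (Q i)) \<Longrightarrow> polycong m (\<Prod>i\<in>A. P i) (\<Prod>i\<in>A. Q i)"
  by (induction A rule: infinite_finite_induct) (auto intro: polycong_mult)

lemma polycong_pderiv:
  assumes "polycong m P Q"
  shows "polycong m (pderiv P) (pderiv Q)"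
  using assms by (auto simp: polycong_coeff coeff_pderiv simp flip: right_diff_distrib)

lemma polycong_dvd: "polycong m P Q \<Longrightarrow> k dvd m \<Longrightarrow> polycong k P Q"
  by (auto simp: polycong_coeff intro: dvd_trans)

section \<open>Reduction of coefficients and cancellation of monic polynomials\<close>

lemma coeff_redX [simp]: "coeff (redX v k P) i = coeff P i mod v ^ k"
  by (simp add: redX_def coeff_map_poly)

lemma redX_eq_iff: "redX v k P = redX v k Q \<longleftrightarrow> polycong (v ^ k) P Q"
  by (simp add: poly_eq_iff[of "redX v k P"] polycong_coeff mod_eq_dvd_iff)

lemma polycong_redX: "polycong (v ^ k) (redX v k P) P"
  by (simp flip: redX_eq_iff add: poly_eq_iff)

lemma redX_redX [simp]: "redX v k (redX v k P) = redX v k P"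
  by (simp add: poly_eq_iff)

lemma degree_redX_le: "degree (redX v k P) \<le> degree P"
  by (rule degree_le) (simp add: coeff_eq_0)

text \<open>Once \<open>U\<close> has reduced coefficients, \<open>P * U\<close> has the leading
  coefficient of \<open>U\<close> in a degree where \<open>C\<close> has none; \<open>m\<close>
  divides this reduced residue, so it is 0. The alternative \<open>C = 0\<close> admits
  \<open>P\<close> of degree 0.\<close>

lemma monic_cancel_cong:
  fixes m :: "'a::field poly"
  assumes P: "lead_coeff P = 1" and cong: "polycong m (P * U) C"
    and C: "C = 0 \<or> degree C < degree P"
  shows "polycong m U 0"
proof -
  define U' where "U' = map_poly (\<lambda>c. c mod m) U"
  have coeff_U': "coeff U' i = coeff U i mod m" for i
    by (simp add: U'_def coeff_map_poly)
  have UU': "polycong m U U'"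
    by (simp add: polycong_coeff coeff_U' minus_mod_eq_mult_div)
  have "U' = 0"
  proof (rule ccontr)
    assume "U' \<noteq> 0"
    have "polycong m (P * U') C"
      using polycong_trans[OF polycong_mult[OF polycong_refl polycong_sym[OF UU']] cong] .
    then have "m dvd coeff (P * U') (degree P + degree U') - coeff C (degree P + degree U')"
      by (simp add: polycong_coeff)
    moreover have "coeff C (degree P + degree U') = 0"
      using C by (auto intro: coeff_eq_0)
    ultimately have "m dvd lead_coeff U'"
      using P by (simp add: coeff_mult_degree_sum)
    then have "lead_coeff U' = 0"
      by (simp add: coeff_U' mod_eq_0_iff_dvd dvd_mod_iff)
    with \<open>U' \<noteq> 0\<close> show False by simp
  qed
  with UU' show ?thesis by simp
qed

text \<open>Applied to constants \<open>C\<close>: to 1 for a contradiction, and to a resultant to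
  obtain its divisibility by \<open>v^ell\<close>.\<close>

lemma monic_multiple_cong_small:
  fixes m :: "'a::field poly"
  assumes P: "lead_coeff P = 1" and cong: "polycong m (P * U) C" and C: "degree C < degree P"
  shows "polycong m C 0"
  using polycong_trans[OF polycong_sym[OF cong] polycong_mult[OF polycong_refl monic_cancel_cong[OF P cong]]] C by simp

text \<open>Neither leading coefficient vanishes modulo \<open>v\<close>, so both degrees survive
  reduction. This expresses the degrees of global polynomials by those of their local
  factors.\<close>

lemma degree_eq_of_cong_monic:
  assumes cong: "polycong v P (smult b Q)" and Q: "lead_coeff Q = 1"
    and P: "\<not> v dvd lead_coeff P" and b: "\<not> v dvd b"
  shows "degree P = degree Q"
proof (rule ccontr)
  have *: "v dvd coeff P i - b * coeff Q i" for i
    using cong by (simp add: polycong_coeff)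
  assume "degree P \<noteq> degree Q"
  then consider "degree P < degree Q" | "degree Q < degree P" by linarith
  then show False
  proof cases
    case 1
    then show ?thesis using *[of "degree Q"] Q b by (simp add: coeff_eq_0)
  next
    case 2
    then show ?thesis using *[of "degree P"] P by (simp add: coeff_eq_0)
  qed
qed

section \<open>Degrees in \<open>t\<close>\<close>

lemma degree_coeff_le_degt: "degree (coeff P i) \<le> degt P"
proof (cases "coeff P i = 0")
  case False
  then have "coeff P i \<in> set (coeffs P)"
    by (metis coeff_in_coeffs coeff_0 le_degree)
  then show ?thesis
    by (auto simp: degt_def intro!: Max_ge)
qed simp

lemma degt_le_iff: "degt P \<le> d \<longleftrightarrow> (\<forall>i. degree (coeff P i) \<le> d)"
proof
  assume "\<forall>i. degree (coeff P i) \<le> d"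
  then have "degree c \<le> d" if "c \<in> set (coeffs P)" for c
    using that by (auto simp: coeffs_def split: if_splits)
  then show "degt P \<le> d" by (simp add: degt_def)
qed (auto intro: order_trans[OF degree_coeff_le_degt])

lemma degt_pderiv_le: "degt (pderiv P) \<le> degt (P :: 'a::field poly poly)"
  unfolding degt_le_iff
proof
  fix i
  have "coeff (pderiv P) i = smult (of_nat (Suc i)) (coeff P (Suc i))"
    by (simp add: coeff_pderiv of_nat_poly del: of_nat_Suc)
  then show "degree (coeff (pderiv P) i) \<le> degt P"
    by (metis degree_smult_le degree_coeff_le_degt order_trans)
qed

lemma degt_mult_le: "degt (P * Q) \<le> degt P + degt (Q :: 'a::idom poly poly)"
proof -
  have "degree (coeff P i * coeff Q j) \<le> degt P + degt Q" for i j
    by (rule order_trans[OF degree_mult_le]) (intro add_mono degree_coeff_le_degt)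
  then show ?thesis
    unfolding degt_le_iff coeff_mult by (auto intro!: degree_sum_le)
qed

lemma coeff_mult_degree_bounds:
  fixes p q :: "'a::idom poly"
  assumes "degree p \<le> a" "degree q \<le> b"
  shows "coeff (p * q) (a + b) = coeff p a * coeff q b"
proof (cases "degree p = a \<and> degree q = b")
  case True
  then show ?thesis using coeff_mult_degree_sum[of p q] by simp
next
  case False
  then have "degree p < a \<or> degree q < b" using assms by auto
  moreover from this have "degree (p * q) < a + b"
    using degree_mult_le[of p q] assms by auto
  ultimately show ?thesis by (auto simp: coeff_eq_0)
qed

text \<open>With \<open>degt_mult_le\<close> this makes the t-degree additive; it bounds the
  t-degree of a divisor of \<open>f\<close> by that of \<open>f\<close>.\<close>

lemma degt_mult_ge:
  fixes P Q :: "'a::idom poly poly"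
  assumes "P \<noteq> 0" "Q \<noteq> 0"
  shows "degt P + degt Q \<le> degt (P * Q)"
proof -
  \<comment> \<open>\<open>T a\<close> extracts the coefficient of \<open>t\<^sup>a\<close>; on top degrees it is multiplicative.\<close>
  define T where "T a R = map_poly (\<lambda>c. coeff c a) R" for a and R :: "'a poly poly"
  have coeff_T: "coeff (T a R) i = coeff (coeff R i) a" for a R i
    by (simp add: T_def coeff_map_poly)
  have T_nz: "T (degt R) R \<noteq> 0" if "R \<noteq> 0" for R
  proof -
    have "\<exists>c \<in> set (coeffs R). c \<noteq> 0 \<and> degree c = degt R"
    \<comment> \<open>The maximum in \<open>degt\<close> runs over a set with 0 inserted, so at
      value 0 it need not come from a coefficient; the leading coefficient then serves.\<close>
    proof (cases "degt R = 0")
      case True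
      then show ?thesis
        using that degree_coeff_le_degt[of R "degree R"]
        by (intro bexI[of _ "lead_coeff R"]) (auto intro: coeff_in_coeffs)
    next
      case False
      have "degt R \<in> insert 0 (degree ` set (coeffs R))"
        unfolding degt_def by (rule Max_in) auto
      then obtain c where "c \<in> set (coeffs R)" "degt R = degree c"
        using False by blast
      with False show ?thesis by (intro bexI[of _ c]) auto
    qed
    then obtain c where c: "c \<in> set (coeffs R)" "c \<noteq> 0" "degree c = degt R"
      by blast
    then obtain i where "coeff R i = c"
      using range_coeff[of R] by (metis imageE insertI2)
    with c have "coeff R i \<noteq> 0" "degree (coeff R i) = degt R"
      by auto
    then have "coeff (T (degt R) R) i \<noteq> 0"
      by (metis coeff_T leading_coeff_neq_0)
    then show ?thesis by auto
  qed
  have "T (degt P + degt Q) (P * Q) = T (degt P) P * T (degt Q) Q"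
    by (rule poly_eqI)
       (simp add: coeff_T coeff_mult[of P] coeff_mult[of "T (degt P) P"] coeff_sum
         coeff_mult_degree_bounds degree_coeff_le_degt)
  then have "T (degt P + degt Q) (P * Q) \<noteq> 0"
    using T_nz assms by simp
  then obtain i where "coeff (coeff (P * Q) i) (degt P + degt Q) \<noteq> 0"
    by (auto simp: poly_eq_iff coeff_T)
  then show ?thesis
    by (rule order_trans[OF le_degree degree_coeff_le_degt])
qed

section \<open>Resultants\<close>

text \<open>Descending powers match the order of the columns of the Sylvester matrix.\<close>

lemma poly_eq_sum_monom_rev:
  assumes "degree P < N"
  shows "(\<Sum>j<N. monom (coeff P (N - 1 - j)) (N - 1 - j)) = P"
proof -
  have "(\<Sum>j<N. monom (coeff P (N - 1 - j)) (N - 1 - j)) = (\<Sum>i<N. monom (coeff P i) i)"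
    by (rule sum.reindex_bij_witness[of _ "\<lambda>i. N - 1 - i" "\<lambda>j. N - 1 - j"]) auto
  also have "\<dots> = (\<Sum>i\<le>N - 1. monom (coeff P i) i)"
    using assms by (intro sum.cong) auto
  also have "\<dots> = P"
    using assms by (intro poly_as_sum_of_monoms') auto
  finally show ?thesis .
qed

text \<open>A common divisor of \<open>p\<close> and \<open>q\<close> modulo a constant thereby
  divides the resultant modulo that constant. For two constants the Sylvester matrix is empty with
  determinant 1, and the identity can fail.\<close>

lemma resultant_in_ideal:
  fixes p q :: "'b::comm_ring_1 poly"
  assumes pos: "0 < degree p + degree q"
  obtains A B where "[:resultant p q:] = A * p + B * q"
proof -
  define m n N where "m = degree p" and "n = degree q" and "N = m + n"
  define S where "S = sylvester_mat p q"
  \<comment> \<open>Row \<open>i\<close> of \<open>S\<close> lists the coefficients of \<open>r i\<close>, so the last row of \<open>adj S \<cdot> S = det S\<close> writes the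
    constant \<open>det S\<close> as a combination of the \<open>r i\<close>.\<close>
  define r where "r i = (if i < n then monom 1 (n - 1 - i) * p else monom 1 (N - 1 - i) * q)" for i
  have S: "S \<in> carrier_mat N N"
    unfolding S_def N_def m_def n_def by (rule sylvester_carrier_mat)
  have adj: "adj_mat S \<in> carrier_mat N N" "adj_mat S * S = det S \<cdot>\<^sub>m 1\<^sub>m N"
    using adj_mat[OF S] by auto
  have N: "N > 0" using pos by (simp add: N_def m_def n_def)
  have S_eq: "S $$ (i, j) = coeff (r i) (N - 1 - j)" if "i < N" "j < N" for i j
  proof -
    have "S $$ (i, j) = (if i < n then coeff (monom 1 (n - i) * p) (N - j)
        else coeff (monom 1 (N - i) * q) (N - j))"
      using that unfolding S_def N_def m_def n_def by (rule sylvester_index_mat2)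
    also have "\<dots> = coeff (r i) (N - 1 - j)"
      using that by (auto simp: r_def coeff_monom_mult N_def Suc_diff_Suc)
    finally show ?thesis .
  qed
  have deg_r: "degree (r i) < N" if "i < N" for i
  proof -
    have "degree (monom 1 k * u) \<le> k + degree u" for k and u :: "'b poly"
      by (rule order_trans[OF degree_mult_le]) (simp add: degree_monom_le)
    from this[of "n - 1 - i" p] this[of "N - 1 - i" q] show ?thesis
      using that by (auto simp: r_def N_def m_def n_def)
  qed
  have "[:det S:] = (\<Sum>j<N. monom ((adj_mat S * S) $$ (N - 1, j)) (N - 1 - j))"
  proof -
    have "(\<Sum>j<N. monom ((adj_mat S * S) $$ (N - 1, j)) (N - 1 - j))
        = (\<Sum>j<N. if j = N - 1 then [:det S:] else 0)"
      using N by (intro sum.cong) (auto simp: adj monom_0)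
    then show ?thesis using N by simp
  qed
  also have "\<dots> = (\<Sum>j<N. \<Sum>i<N. smult (adj_mat S $$ (N - 1, i)) (monom (coeff (r i) (N - 1 - j)) (N - 1 - j)))"
  proof (rule sum.cong[OF refl])
    fix j assume j: "j \<in> {..<N}"
    have "(adj_mat S * S) $$ (N - 1, j) = (\<Sum>i<N. adj_mat S $$ (N - 1, i) * S $$ (i, j))"
      using N j S adj(1) by (simp add: scalar_prod_def atLeast0LessThan)
    also have "\<dots> = (\<Sum>i<N. adj_mat S $$ (N - 1, i) * coeff (r i) (N - 1 - j))"
      using j by (simp add: S_eq)
    finally show "monom ((adj_mat S * S) $$ (N - 1, j)) (N - 1 - j) =
        (\<Sum>i<N. smult (adj_mat S $$ (N - 1, i)) (monom (coeff (r i) (N - 1 - j)) (N - 1 - j)))"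
      by (simp add: smult_monom monom_hom.hom_sum)
  qed
  also have "\<dots> = (\<Sum>i<N. smult (adj_mat S $$ (N - 1, i)) (\<Sum>j<N. monom (coeff (r i) (N - 1 - j)) (N - 1 - j)))"
    by (subst sum.swap) (simp add: smult_sum2)
  also have "\<dots> = (\<Sum>i<N. smult (adj_mat S $$ (N - 1, i)) (r i))"
    by (intro sum.cong refl arg_cong2[of _ _ _ _ smult] poly_eq_sum_monom_rev deg_r) auto
  also have "\<dots> = (\<Sum>i<N. (if i < n then smult (adj_mat S $$ (N - 1, i)) (monom 1 (n - 1 - i)) else 0) * p
      + (if i < n then 0 else smult (adj_mat S $$ (N - 1, i)) (monom 1 (N - 1 - i))) * q)"
    by (intro sum.cong) (auto simp: r_def)
  also have "\<dots> = (\<Sum>i<N. if i < n then smult (adj_mat S $$ (N - 1, i)) (monom 1 (n - 1 - i)) else 0) * p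
      + (\<Sum>i<N. if i < n then 0 else smult (adj_mat S $$ (N - 1, i)) (monom 1 (N - 1 - i))) * q"
    by (simp only: sum.distrib sum_distrib_right)
  finally show ?thesis
    by (intro that) (simp add: resultant_def S_def)
qed

text \<open>Every term of the Leibniz expansion takes one entry from each row, so row bounds add
  up.\<close>

lemma degree_det_le:
  fixes A :: "'b::comm_ring_1 poly mat"
  assumes A: "A \<in> carrier_mat N N" and b: "\<And>i j. i < N \<Longrightarrow> j < N \<Longrightarrow> degree (A $$ (i, j)) \<le> b i"
  shows "degree (det A) \<le> (\<Sum>i<N. b i)"
  unfolding det_def'[OF A]
proof (rule degree_sum_le)
  show "finite {\<pi>. \<pi> permutes {0..<N}}" by (simp add: finite_permutations)
  fix \<pi> assume "\<pi> \<in> {\<pi>. \<pi> permutes {0..<N}}"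
  then have *: "\<pi> i < N" if "i < N" for i
    using that permutes_in_image[of \<pi> "{0..<N}" i] by simp
  have "degree (\<Prod>i = 0..<N. A $$ (i, \<pi> i)) \<le> (\<Sum>i = 0..<N. degree (A $$ (i, \<pi> i)))"
    using degree_prod_sum_le[of "{0..<N}" "\<lambda>i. A $$ (i, \<pi> i)"] by (simp add: o_def)
  also have "\<dots> \<le> (\<Sum>i = 0..<N. b i)"
    by (rule sum_mono) (use b * in auto)
  finally show "degree (signof \<pi> * (\<Prod>i = 0..<N. A $$ (i, \<pi> i))) \<le> (\<Sum>i<N. b i)"
    by (auto simp: sign_def atLeast0LessThan)
qed

text \<open>The Sylvester matrix has \<open>degree q\<close> rows of coefficients of
  \<open>p\<close> and \<open>degree p\<close> rows of coefficients of \<open>q\<close>.\<close>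

lemma degree_resultant_le:
  fixes p q :: "'b::comm_ring_1 poly poly"
  shows "degree (resultant p q) \<le> degree q * degt p + degree p * degt q"
proof -
  define m n where "m = degree p" and "n = degree q"
  have "degree (det (sylvester_mat p q)) \<le> (\<Sum>i<m + n. if i < n then degt p else degt q)"
  proof (rule degree_det_le)
    show "sylvester_mat p q \<in> carrier_mat (m + n) (m + n)"
      unfolding m_def n_def by (rule sylvester_carrier_mat)
    fix i j assume "i < m + n" "j < m + n"
    then show "degree (sylvester_mat p q $$ (i, j)) \<le> (if i < n then degt p else degt q)"
      using sylvester_index_mat[of i p q j] by (auto simp: m_def n_def degree_coeff_le_degt)
  qed
  also have "\<dots> = (\<Sum>i<n. degt p) + (\<Sum>i\<in>{n..<m + n}. degt q)"
  proof -
    have "{..<m + n} = {..<n} \<union> {n..<m + n}" by auto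
    then show ?thesis
      by (simp add: sum.union_disjoint ivl_disj_int)
  qed
  finally show ?thesis
    by (simp add: resultant_def m_def n_def)
qed

text \<open>Over the fraction field a zero resultant means a nonconstant gcd, which irreducibility
  makes an associate of \<open>p\<close>.\<close>

lemma resultant_zero_irreducible_dvd:
  fixes p q :: "'b::idom poly"
  assumes res: "resultant p q = 0" and irr: "irreducible (map_poly to_fract p)"
  shows "map_poly to_fract p dvd map_poly to_fract q"
proof -
  have hom: "inj_comm_ring_hom (to_fract :: 'b \<Rightarrow> 'b fract)" ..
  let ?p = "map_poly to_fract p" and ?q = "map_poly to_fract q"
  have "resultant ?p ?q = 0"
    using res by (simp add: inj_comm_ring_hom.resultant_hom[OF hom])
  then have "degree (gcd ?p ?q) \<noteq> 0"
    by (simp add: resultant_0_gcd)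
  then have "\<not> is_unit (gcd ?p ?q)"
    by (simp add: poly_dvd_1)
  moreover have "gcd ?p ?q dvd ?p" by simp
  ultimately have "?p dvd gcd ?p ?q"
    using irr irreducibleD' by blast
  then show ?thesis by auto
qed

section \<open>Primitive factors over the coefficient ring\<close>

text \<open>Gauss's lemma, one factor at a time.\<close>

lemma primitive_prod:
  fixes g :: "nat \<Rightarrow> 'b::ufd poly"
  assumes "\<And>j. j < s \<Longrightarrow> content_ff_ff (g j) =dff 1"
  shows "content_ff_ff (\<Prod>j<s. g j) =dff 1"
  using assms
proof (induction s)
  case 0
  have "content_ff (1 :: 'b fract poly) =dff 1"
    using content_ff_iff[of "1 :: 'b fract" 1] content_ff_divides_ff[of "1 :: 'b fract" 1]
    by (auto simp: eq_dff_def)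
  then show ?case by simp
next
  case (Suc s)
  have "content_ff (map_poly to_fract (\<Prod>j<s. g j) * map_poly to_fract (g s))
      =dff content_ff_ff (\<Prod>j<s. g j) * content_ff_ff (g s)"
    by (rule gauss_lemma)
  also have "content_ff_ff (g s) =dff 1"
    using Suc.prems by simp
  finally have "content_ff (map_poly to_fract (\<Prod>j<s. g j) * map_poly to_fract (g s))
      =dff content_ff_ff (\<Prod>j<s. g j)"
    by simp
  also have "\<dots> =dff 1"
    using Suc by simp
  finally show ?case
    by (simp add: hom_distribs)
qed

text \<open>Each \<open>G j\<close> is a scalar multiple of a primitive \<open>g j\<close>. By
  Gauss's lemma the product of the \<open>g j\<close> is primitive, hence divides \<open>f\<close>
  already over the ring, and equality of degrees makes the cofactor a constant.\<close>

lemma monic_factors_lift: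
  fixes f :: "'b::ufd poly" and s :: nat
  assumes f: "f \<noteq> 0" and G: "\<And>j. j < s \<Longrightarrow> lead_coeff (G j) = 1"
    and fact: "map_poly to_fract f = smult \<alpha> (\<Prod>j<s. G j)"
  obtains g c where "f = smult c (\<Prod>j<s. g j)"
    and "\<And>j. j < s \<Longrightarrow> map_poly to_fract (g j) = smult (to_fract (lead_coeff (g j))) (G j)"
proof -
  have "\<exists>h c. content_ff_ff h =dff 1 \<and> G j = smult c (map_poly to_fract h)" if j: "j < s" for j
  proof -
    have "(\<Prod>j<s. G j) = G j * (\<Prod>j\<in>{..<s} - {j}. G j)"
      using j by (intro prod.remove) auto
    then have "map_poly to_fract f = G j * smult \<alpha> (\<Prod>j\<in>{..<s} - {j}. G j)"
      using fact by simp
    moreover have "G j \<noteq> 0" using G[OF j] by auto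
    ultimately show ?thesis
      using factorization_to_fract[of "G j" f] by blast
  qed
  then obtain g c where g: "content_ff_ff (g j) =dff 1"
    and Gg: "G j = smult (c j) (map_poly to_fract (g j))" if "j < s" for j
    by metis
  have g_lead: "map_poly to_fract (g j) = smult (to_fract (lead_coeff (g j))) (G j)" if "j < s" for j
  proof -
    have "c j \<noteq> 0"
      using G[OF that] Gg[OF that] by auto
    then have "c j * to_fract (lead_coeff (g j)) = 1"
      using G[OF that] by (simp add: Gg[OF that])
    then show ?thesis
      by (simp add: Gg[OF that] mult.commute)
  qed
  define P where "P = (\<Prod>j<s. g j)"
  define \<beta> where "\<beta> = \<alpha> * (\<Prod>j<s. c j)"
  have fP: "map_poly to_fract f = smult \<beta> (map_poly to_fract P)"
  proof -
    interpret map_poly_inj_idom_hom "to_fract :: 'b \<Rightarrow> 'b fract" ..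
    show ?thesis
      unfolding fact P_def \<beta>_def by (simp add: Gg prod_smult hom_prod)
  qed
  have "map_poly to_fract P dvd map_poly to_fract f"
    unfolding fP by (rule dvd_smult) simp
  \<comment> \<open>Divisibility descends from the fraction field once the contents divide:
    \<open>P\<close> is primitive, and the content of \<open>f\<close> lies in the ring.\<close>
  moreover have "divides_ff (content_ff_ff P) (content_ff_ff f)"
  proof -
    have "divides_ff (content_ff_ff P) 1"
      using primitive_prod[of s g] g by (simp add: P_def eq_dff_def)
    moreover obtain z where "content_ff_ff f = to_fract z"
      using content_ff_map_poly_to_fract[of f] by blast
    then have "divides_ff 1 (content_ff_ff f)"
      by (simp add: divides_ff_def)
    ultimately show ?thesis by (rule divides_ff_trans)
  qed
  ultimately have "P dvd f"
    using dvd_PM_iff[of P f] by blast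
  then obtain Q where Q: "f = P * Q" by (elim dvdE)
  have "\<beta> \<noteq> 0" using fP f by auto
  then have "degree f = degree P"
    using arg_cong[OF fP, of degree] by simp
  with Q f have "degree Q = 0"
    by (simp add: degree_mult_eq)
  then obtain d where "Q = [:d:]" by (rule degree_eq_zeroE)
  with Q g_lead show ?thesis
    by (intro that[of d g]) (simp_all add: P_def)
qed

section \<open>Polynomials over the completion\<close>

text \<open>Euclid's algorithm as induction on the degree of \<open>b\<close>: replace
  \<open>b\<close> by \<open>b mod v\<close> if it is large, by \<open>v mod b\<close> otherwise.
  The latter is nonzero, as \<open>b\<close> is no unit, and too small to be divisible by
  \<open>v\<close>.\<close>

lemma irreducible_not_dvd_inverse:
  fixes v b :: "'a::field poly"
  assumes v: "irreducible v" and "\<not> v dvd b"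
  shows "\<exists>c. v dvd b * c - 1"
  using assms(2)
proof (induction "degree b" arbitrary: b rule: less_induct)
  case (less b)
  have inv: "\<exists>c. v dvd b * c - 1" if "is_unit b"
    using that by (metis dvdE dvd_0_right diff_self)
  have v0: "v \<noteq> 0" "b \<noteq> 0" using v less.prems by auto
  have nmod: "\<not> v dvd b mod v" using less.prems by (simp add: dvd_mod_iff)
  consider "degree v \<le> degree b" | "is_unit b" | "degree b < degree v" "\<not> is_unit b"
    by linarith
  then show ?case
  proof cases
    case 1
    have "b mod v \<noteq> 0" using nmod by auto
    then have "degree (b mod v) < degree b"
      using 1 degree_mod_less[OF v0(1), of b] by auto
    then obtain c where c: "v dvd (b mod v) * c - 1"
      using less.hyps nmod by blast
    have "b * c - 1 = ((b mod v) * c - 1) + v * (b div v * c)"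
      using mult_div_mod_eq[of v b] by (metis (no_types, lifting) add.commute add_diff_eq distrib_right mult.assoc)
    then show ?thesis using c by (metis dvd_add dvd_triv_left)
  next
    case 2
    then show ?thesis by (rule inv)
  next
    case 3
    have "v mod b \<noteq> 0"
    proof
      assume "v mod b = 0"
      then have "b dvd v" by (simp add: mod_eq_0_iff_dvd)
      then have "v dvd b" using 3(2) v irreducibleD' by blast
      with less.prems show False by simp
    qed
    then have deg: "degree (v mod b) < degree b"
      using degree_mod_less[OF v0(2), of v] by auto
    moreover have "\<not> v dvd v mod b"
      using dvd_imp_degree_le[of v "v mod b"] deg 3(1) \<open>v mod b \<noteq> 0\<close> by linarith
    ultimately obtain c where c: "v dvd (v mod b) * c - 1"
      using less.hyps by blast
    obtain q where q: "v mod b = v - b * q"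
      using minus_mult_div_eq_mod[of v b] by metis
    have "b * (- q * c) - 1 = ((v - b * q) * c - 1) - v * c"
      by (simp add: algebra_simps)
    then have "b * (- q * c) - 1 = ((v mod b) * c - 1) - v * c"
      by (simp only: q)
    then have "v dvd b * (- q * c) - 1"
      using c by (metis dvd_diff dvd_triv_left)
    then show ?thesis by blast
  qed
qed

text \<open>If \<open>c\<close> inverts \<open>b\<close> modulo \<open>v\<close>, then
  \<open>(1 - b * c)^k\<close> is divisible by \<open>v^k\<close> and differs from 1 by a multiple
  of \<open>b\<close>.\<close>

lemma irreducible_not_dvd_inverse_power:
  fixes v b :: "'a::field poly"
  assumes "irreducible v" "\<not> v dvd b"
  obtains c where "v ^ k dvd b * c - 1"
proof -
  obtain c where c: "v dvd b * c - 1"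
    using irreducible_not_dvd_inverse[OF assms] by blast
  have "\<exists>d. 1 - (1 - b * c) ^ k = b * d"
  proof (induction k)
    case (Suc k)
    then obtain d where "1 - (1 - b * c) ^ k = b * d" by blast
    then have *: "(1 - b * c) ^ k = 1 - b * d" by (simp add: algebra_simps)
    have "1 - (1 - b * c) ^ Suc k = b * (d + c * (1 - b * d))"
      unfolding power_Suc * by (simp add: algebra_simps)
    then show ?case by blast
  qed simp
  then obtain d where d: "1 - (1 - b * c) ^ k = b * d" by blast
  have "v dvd 1 - b * c"
    using c by (simp add: dvd_diff_commute)
  then have "v ^ k dvd (1 - b * c) ^ k"
    by (rule dvd_power_same)
  also have "(1 - b * c) ^ k = 1 - b * d"
    using d by (simp add: algebra_simps)
  finally show ?thesis
    using that dvd_diff_commute by blast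
qed

lemma dvd_power_cancel:
  fixes v b :: "'a::field poly"
  assumes "irreducible v" "\<not> v dvd b" "v ^ k dvd b * c"
  shows "v ^ k dvd c"
  using assms(3)
proof (induction k arbitrary: c)
  case (Suc k)
  have "v dvd b * c"
    using Suc.prems by (metis dvd_mult_left power_Suc)
  then have "v dvd c"
    using assms prime_elem_dvd_mult_iff[of v b c] by simp
  then obtain d where d: "c = v * d" by (elim dvdE)
  have "v ^ k dvd b * d"
    using Suc.prems assms(1) by (auto simp: d mult.left_commute)
  then have "v ^ k dvd d" by (rule Suc.IH)
  then show ?case by (simp add: d)
qed simp

text \<open>The description in \<open>vfrac\<close> is well posed: \<open>a\<close> times an inverse
  of \<open>b\<close> modulo \<open>v^k\<close> satisfies it, and cancelling denominators prime to
  \<open>v\<close> shows that the residue does not depend on the fraction chosen.\<close>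

lemma vfrac_cong:
  fixes v :: "'a::field poly"
  assumes v: "irreducible v" and x: "x = Fract a b" and b: "\<not> v dvd b"
  shows "v ^ k dvd vfrac v k x * b - a"
proof -
  obtain c where c: "v ^ k dvd b * c - 1"
    using irreducible_not_dvd_inverse_power[OF v b] .
  have nz: "b' \<noteq> 0" if "\<not> v dvd b'" for b'
    using that by auto
  let ?P = "\<lambda>r. r mod v ^ k = r \<and>
      (\<exists>a b. x = Fract a b \<and> \<not> v dvd b \<and> (r * b) mod v ^ k = a mod v ^ k)"
  have P: "v ^ k dvd r * b - a" if r: "?P r" for r
  proof -
    obtain a' b' where a': "x = Fract a' b'" "\<not> v dvd b'" "v ^ k dvd r * b' - a'"
      using r by (auto simp: mod_eq_dvd_iff)
    have "a * b' = a' * b"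
      using x a'(1) nz[OF b] nz[OF a'(2)] by (simp add: eq_fract)
    then have "b' * (r * b - a) = b * (r * b' - a')"
      by (simp add: algebra_simps)
    then have "v ^ k dvd b' * (r * b - a)"
      using a'(3) by simp
    then show ?thesis
      by (rule dvd_power_cancel[OF v a'(2)])
  qed
  have ex: "?P ((a * c) mod v ^ k)"
  proof (intro conjI exI)
    show "x = Fract a b" "\<not> v dvd b" by fact+
    have "a * c * b - a = a * (b * c - 1)" by (simp add: algebra_simps)
    then have "a * c * b mod v ^ k = a mod v ^ k"
      using c by (simp add: mod_eq_dvd_iff)
    then show "(a * c) mod v ^ k * b mod v ^ k = a mod v ^ k"
      by (simp add: mod_mult_left_eq)
  qed simp
  have uniq: "r = r'" if r: "?P r" and r': "?P r'" for r r'
  proof -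
    have "v ^ k dvd b * (r - r')"
      using dvd_diff[OF P[OF r] P[OF r']] by (simp add: algebra_simps)
    then have "r mod v ^ k = r' mod v ^ k"
      unfolding mod_eq_dvd_iff by (rule dvd_power_cancel[OF v b])
    then show ?thesis
      unfolding conjunct1[OF r] conjunct1[OF r'] .
  qed
  have "?P (vfrac v k x)"
    unfolding vfrac_def by (rule theI[of ?P, OF ex uniq[OF _ ex]])
  then show ?thesis by (rule P)
qed

text \<open>Needed for \<open>map_poly\<close> to act coefficientwise in
  \<open>vredX\<close>.\<close>

lemma vfrac_0:
  fixes v :: "'a::field poly"
  assumes v: "irreducible v"
  shows "vfrac v k 0 = 0"
  unfolding vfrac_def
proof (rule the_equality)
  have "(0 :: 'a poly fract) = Fract 0 1 \<and> \<not> v dvd 1 \<and> 0 * 1 mod v ^ k = 0 mod v ^ k"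
    using irreducible_not_unit[OF v] by (simp add: Zero_fract_def)
  then show "0 mod v ^ k = 0 \<and>
      (\<exists>a b. (0 :: 'a poly fract) = Fract a b \<and> \<not> v dvd b \<and> 0 * b mod v ^ k = a mod v ^ k)"
    by (metis mod_0)
next
  fix r assume r: "r mod v ^ k = r \<and>
      (\<exists>a b. (0 :: 'a poly fract) = Fract a b \<and> \<not> v dvd b \<and> r * b mod v ^ k = a mod v ^ k)"
  then obtain a b where ab: "(0 :: 'a poly fract) = Fract a b" "\<not> v dvd b" "r * b mod v ^ k = a mod v ^ k"
    by blast
  have "b \<noteq> 0" using ab(2) by auto
  then have "a = 0" using ab(1) by (simp add: Zero_fract_def eq_fract)
  with ab(3) have "v ^ k dvd b * r" by (simp add: mod_eq_0_iff_dvd mult.commute)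
  then have "v ^ k dvd r" by (rule dvd_power_cancel[OF v ab(2)])
  with r show "r = 0" by (metis mod_eq_0_iff_dvd)
qed

lemma vredX_cong:
  fixes v :: "'a::field poly"
  assumes v: "irreducible v" and b: "\<not> v dvd b"
    and g: "map_poly to_fract g = smult (to_fract b) G"
  shows "polycong (v ^ k) g (smult b (vredX v k G))"
  unfolding polycong_coeff
proof
  fix i
  have "b \<noteq> 0" using b by auto
  then have "coeff G i = Fract (coeff g i) b"
    using arg_cong[OF g, of "\<lambda>P. coeff P i"]
    by (simp add: coeff_map_poly Fract_conv_to_fract field_simps)
  from dvd_diff_commute[THEN iffD1, OF vfrac_cong[OF v this b, of k]]
  show "v ^ k dvd coeff g i - coeff (smult b (vredX v k G)) i"
    by (simp add: vredX_def coeff_map_poly vfrac_0[OF v] mult.commute)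
qed

section \<open>Components of elements of O_v[X]\<close>

lemma OvX_elem_reduced: "OvX_elem v P \<Longrightarrow> redX v k (P k) = P k"
  unfolding OvX_elem_def by (metis redX_redX)

lemma OvX_elem_cong: "OvX_elem v P \<Longrightarrow> polycong (v ^ k) (P k) (P (Suc k))"
  unfolding OvX_elem_def by (metis polycong_redX)

text \<open>A monic element of degree 0 would be 1, a unit.\<close>

lemma OvX_irreducible_monic_degree_pos:
  fixes v :: "'a::field poly"
  assumes P: "OvX_elem v P" "OvX_monic v P" "OvX_irreducible v P" and k: "k > 0"
  shows "lead_coeff (P k) = 1" "degree (P k) > 0"
proof -
  obtain d where d: "degree (P k) = d" "coeff (P k) d = 1" if "k > 0" for k
    using P(2) unfolding OvX_monic_def by blast
  show "lead_coeff (P k) = 1" using d k by simp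
  show "degree (P k) > 0"
  proof (rule ccontr)
    assume "\<not> degree (P k) > 0"
    then have "d = 0" using d k by simp
    have "P l = redX v l 1" for l
    \<comment> \<open>Monicity says nothing at level 0, where the modulus is 1 and every reduced
      polynomial is 0.\<close>
    proof (cases "l = 0")
      case True
      then show ?thesis
        using OvX_elem_reduced[OF P(1), of 0] by (simp add: poly_eq_iff)
    next
      case False
      then have "P l = 1"
        using d[of l] \<open>d = 0\<close> degree_0_id[of "P l"] by simp
      then show ?thesis
        using OvX_elem_reduced[OF P(1), of l] by simp
    qed
    then have P1: "P = embX v 1"
      by (simp add: embX_def fun_eq_iff)
    have "mulOv v P P = embX v 1"
    proof
      fix l
      have "polycong (v ^ l) (P l * P l) (1 * 1)"
        unfolding P1 embX_def by (intro polycong_mult polycong_redX)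
      then show "mulOv v P P l = embX v 1 l"
        by (simp add: mulOv_def embX_def redX_eq_iff)
    qed
    with P(1) have "OvX_unit v P" unfolding OvX_unit_def by blast
    with P(3) show False by (simp add: OvX_irreducible_def)
  qed
qed

text \<open>Replacing the division in \<open>f F_j' / F_j\<close> by the product of the other
  factors gives a compatible bounded sequence; it is the only solution because the monic
  \<open>F j\<close> can be cancelled.\<close>

lemma PhiOv_eq:
  fixes v :: "'a::field poly"
  assumes F: "\<And>i. i < r \<Longrightarrow> OvX_elem v (F i)" "OvX_monic v (F j)" and j: "j < (r::nat)"
    and fact: "\<And>k. embX v f k = redX v k (smult (lead_coeff f) (\<Prod>i<r. F i k))"
  shows "PhiOv v f (F j) k =
    redX v k (smult (lead_coeff f) (pderiv (F j k) * (\<Prod>i\<in>{..<r} - {j}. F i k)))"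
proof -
  define E where "E k = smult (lead_coeff f) (pderiv (F j k) * (\<Prod>i\<in>{..<r} - {j}. F i k))" for k
  define H where "H k = redX v k (E k)" for k
  let ?P = "\<lambda>H. OvX_elem v H \<and> mulOv v (F j) H = mulOv v (embX v f) (derOv v (F j))"
  have "H k = redX v k (H (Suc k))" for k
  proof -
    have "polycong (v ^ k) (E k) (E (Suc k))"
      unfolding E_def using F(1) j
      by (intro polycong_smult polycong_mult polycong_pderiv polycong_prod OvX_elem_cong) auto
    moreover have "polycong (v ^ k) (H (Suc k)) (E (Suc k))"
      unfolding H_def by (rule polycong_dvd[OF polycong_redX]) simp
    ultimately have "polycong (v ^ k) (E k) (H (Suc k))"
      by (rule polycong_trans[OF _ polycong_sym])
    then show ?thesis
      by (simp add: H_def[of k] redX_eq_iff)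
  qed
  moreover have "\<exists>d. \<forall>k. degree (H k) \<le> d"
  proof -
    have "\<forall>i<r. \<exists>d. \<forall>k. degree (F i k) \<le> d"
      using F(1) unfolding OvX_elem_def by blast
    then obtain d where d: "degree (F i k) \<le> d i" if "i < r" for i k
      by metis
    have "degree (H k) \<le> d j + (\<Sum>i\<in>{..<r} - {j}. d i)" for k
    proof -
      have "degree (H k) \<le> degree (pderiv (F j k)) + degree (\<Prod>i\<in>{..<r} - {j}. F i k)"
        unfolding H_def E_def
        by (rule order_trans[OF degree_redX_le order_trans[OF degree_smult_le degree_mult_le]])
      also have "degree (\<Prod>i\<in>{..<r} - {j}. F i k) \<le> (\<Sum>i\<in>{..<r} - {j}. degree (F i k))"
        using degree_prod_sum_le[of "{..<r} - {j}" "\<lambda>i. F i k"] by (simp add: o_def)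
      also have "\<dots> \<le> (\<Sum>i\<in>{..<r} - {j}. d i)"
        by (intro sum_mono) (use d in auto)
      also have "degree (pderiv (F j k)) \<le> d j"
        using d[OF j, of k] degree_pderiv_le[of "F j k"] by linarith
      finally show ?thesis by simp
    qed
    then show ?thesis by blast
  qed
  ultimately have H_elem: "OvX_elem v H"
    unfolding OvX_elem_def by blast
  have "mulOv v (F j) H k = mulOv v (embX v f) (derOv v (F j)) k" for k
  proof -
    have "polycong (v ^ k) (F j k * H k) (F j k * E k)"
      unfolding H_def by (intro polycong_mult polycong_refl polycong_redX)
    also have "F j k * E k = smult (lead_coeff f) (\<Prod>i<r. F i k) * pderiv (F j k)"
      using j by (simp add: E_def prod.remove[of "{..<r}" j] algebra_simps)
    also have "polycong (v ^ k) \<dots> (embX v f k * derOv v (F j) k)"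
      unfolding derOv_def fact by (intro polycong_mult polycong_sym[OF polycong_redX])
    finally show ?thesis
      by (simp add: mulOv_def redX_eq_iff)
  qed
  then have H_eq: "mulOv v (F j) H = mulOv v (embX v f) (derOv v (F j))"
    by (simp add: fun_eq_iff)
  have "PhiOv v f (F j) = H"
    unfolding PhiOv_def
  proof (rule the_equality)
    show "?P H" using H_elem H_eq by simp
  next
    fix H' assume H': "?P H'"
    show "H' = H"
    proof
      fix k
      have "polycong (v ^ k) (H' k - H k) 0"
      \<comment> \<open>Cancellation uses monicity, given only for positive \<open>k\<close>; modulo
        \<open>v^0 = 1\<close> every congruence holds.\<close>
      proof (cases "k = 0")
        case False
        have "lead_coeff (F j k) = 1"
          using F(2) False unfolding OvX_monic_def by fastforce
        moreover have "polycong (v ^ k) (F j k * H' k) (F j k * H k)"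
          using H' H_eq unfolding redX_eq_iff[symmetric] mulOv_def fun_eq_iff by metis
        then have "polycong (v ^ k) (F j k * (H' k - H k)) 0"
          by (simp add: polycong_def algebra_simps)
        ultimately show ?thesis
          by (rule monic_cancel_cong) simp
      qed (simp add: polycong_def)
      then have "redX v k (H' k) = redX v k (H k)"
        by (simp add: redX_eq_iff polycong_def)
      then show "H' k = H k"
        using H' H_elem OvX_elem_reduced by metis
    qed
  qed
  then show ?thesis by (simp add: H_def E_def)
qed

section \<open>Local and global factors\<close>

lemma not_dvd_lead_coeff_factor:
  fixes g :: "nat \<Rightarrow> 'b::idom poly"
  assumes f: "f = smult c (\<Prod>j<s. g j)" and v: "\<not> v dvd lead_coeff f" and j: "j < s"
  shows "\<not> v dvd lead_coeff (g j)"
proof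
  assume "v dvd lead_coeff (g j)"
  also have "lead_coeff (g j) dvd (\<Prod>j<s. lead_coeff (g j))"
    using j by (intro dvd_prodI) auto
  also have "\<dots> dvd lead_coeff f"
    by (simp add: f lead_coeff_prod)
  finally show False using v by simp
qed

text \<open>The situation at the single level \<open>ell\<close>, without the completion:
  \<open>F i\<close> is a local factor modulo \<open>v^ell\<close>, \<open>g j\<close> an integral
  multiple of a global factor, and \<open>B j\<close> the set of local factors making up
  \<open>g j\<close>.\<close>

locale local_global_factorization =
  fixes v :: "'a::field poly" and ell r s :: nat and f :: "'a poly poly"
    and F g :: "nat \<Rightarrow> 'a poly poly" and B :: "nat \<Rightarrow> nat set" and c :: "'a poly"
  assumes v_irr: "irreducible v" and ell: "ell \<ge> 1" and v_lead: "\<not> v dvd lead_coeff f"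
    and F_monic: "\<And>i. i < r \<Longrightarrow> lead_coeff (F i) = 1"
    and F_deg: "\<And>i. i < r \<Longrightarrow> 0 < degree (F i)"
    and f_cong: "polycong (v ^ ell) f (smult (lead_coeff f) (\<Prod>i<r. F i))"
    and sqf: "\<And>Q R. polycong v f (Q * Q * R) \<Longrightarrow> \<exists>U. polycong v (Q * U) 1"
    and B_sub: "\<And>j. j < s \<Longrightarrow> B j \<subseteq> {..<r}"
    and f_eq: "f = smult c (\<Prod>j<s. g j)"
    and g_cong: "\<And>j. j < s \<Longrightarrow> polycong (v ^ ell) (g j) (smult (lead_coeff (g j)) (\<Prod>i\<in>B j. F i))"
    and g_irr: "\<And>j. j < s \<Longrightarrow> irreducible (map_poly to_fract (g j))"
    and sep: "separable_K f" and deg_f: "0 < degree f"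
    and big: "(2 * degree f - 1) * degt f < ell * degree v"
begin

text \<open>The division-free form of \<open>f F_j' / F_j\<close> modulo \<open>v^ell\<close> from
  \<open>PhiOv_eq\<close>.\<close>

definition Phi :: "nat \<Rightarrow> 'a poly poly" where
  "Phi j = redX v ell (smult (lead_coeff f) (pderiv (F j) * (\<Prod>i\<in>{..<r} - {j}. F i)))"

text \<open>The polynomial H of the overview. The entries of \<open>x\<close> range over all of F_q;
  the prime field enters only at the end.\<close>

definition comb :: "(nat \<Rightarrow> 'a) \<Rightarrow> 'a poly poly" where
  "comb x = (\<Sum>j<r. smult [:x j:] (Phi j))"

section \<open>Degree estimates and the partition of the local factors into blocks\<close>

lemma v_nz: "v \<noteq> 0"
  using v_irr by auto

lemma f_nz: "f \<noteq> 0"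
  using deg_f by auto

lemma c_nz: "c \<noteq> 0"
  using f_nz f_eq by auto

lemma g_nz: "j < s \<Longrightarrow> g j \<noteq> 0"
  using g_irr[of j] by auto

lemma degree_modulus: "degree (v ^ ell) = ell * degree v"
  by (simp add: degree_power_eq v_nz)

lemma degt_less: "degt f < ell * degree v"
proof -
  have "1 * degt f \<le> (2 * degree f - 1) * degt f"
    using deg_f by (intro mult_right_mono) auto
  then show ?thesis using big by linarith
qed

lemma cong_v: "polycong (v ^ ell) P Q \<Longrightarrow> polycong v P Q"
  using ell by (auto intro: polycong_dvd dvd_power)

lemma small_dvd_imp_zero:
  assumes "v ^ ell dvd a" "degree a < ell * degree v"
  shows "a = 0"
  using assms dvd_imp_degree_le degree_modulus by (metis not_less)

lemma small_cong_imp_eq: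
  assumes "polycong (v ^ ell) P Q"
    and "\<And>i. degree (coeff P i) < ell * degree v" "\<And>i. degree (coeff Q i) < ell * degree v"
  shows "P = Q"
proof (rule poly_eqI)
  fix i
  have "coeff P i - coeff Q i = 0"
    using assms by (intro small_dvd_imp_zero degree_diff_less) (auto simp: polycong_coeff)
  then show "coeff P i = coeff Q i" by simp
qed

lemma lead_prod_F: "A \<subseteq> {..<r} \<Longrightarrow> lead_coeff (\<Prod>i\<in>A. F i) = 1"
  by (subst lead_coeff_prod) (auto intro!: prod.neutral F_monic)

lemma degree_prod_F: "A \<subseteq> {..<r} \<Longrightarrow> degree (\<Prod>i\<in>A. F i) = (\<Sum>i\<in>A. degree (F i))"
  by (rule degree_prod_eq_sum_degree) (use F_deg in force)

lemma degree_f: "degree f = (\<Sum>i<r. degree (F i))"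
  using degree_eq_of_cong_monic[OF cong_v[OF f_cong] _ v_lead v_lead]
    lead_prod_F[of "{..<r}"] degree_prod_F[of "{..<r}"] by simp

lemma v_lead_g: "j < s \<Longrightarrow> \<not> v dvd lead_coeff (g j)"
  using not_dvd_lead_coeff_factor f_eq v_lead by blast

lemma degree_g: "j < s \<Longrightarrow> degree (g j) = (\<Sum>i\<in>B j. degree (F i))"
  using degree_eq_of_cong_monic[OF cong_v[OF g_cong] lead_prod_F v_lead_g v_lead_g] B_sub
  by (simp add: degree_prod_F)

lemma degree_g_pos:
  assumes "j < s"
  shows "0 < degree (g j)"
proof -
  have "\<not> is_unit (map_poly to_fract (g j))" "map_poly to_fract (g j) \<noteq> 0"
    using g_irr[OF assms] by auto
  then show ?thesis by (simp add: is_unit_iff_degree)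
qed

text \<open>A shared \<open>F i\<close> would divide \<open>f\<close> twice modulo \<open>v\<close>.
  Squarefreeness then makes it a unit modulo \<open>v\<close>, impossible for a monic polynomial of
  positive degree.\<close>

lemma B_disjoint:
  assumes j: "j < s" "j' < s" "j \<noteq> j'"
  shows "B j \<inter> B j' = {}"
proof (rule ccontr)
  assume "B j \<inter> B j' \<noteq> {}"
  then obtain i where i: "i \<in> B j" "i \<in> B j'" by auto
  then have ir: "i < r" using B_sub j by auto
  have F_dvd: "\<exists>R. polycong v (g k) (F i * R)" if "k < s" "i \<in> B k" for k
  proof -
    have "finite (B k)" using B_sub[OF that(1)] finite_subset by blast
    then have "(\<Prod>i\<in>B k. F i) = F i * (\<Prod>i\<in>B k - {i}. F i)"
      using that by (simp add: prod.remove)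
    with cong_v[OF g_cong[OF that(1)]] show ?thesis
      by (metis mult_smult_right)
  qed
  obtain R R' where R: "polycong v (g j) (F i * R)" "polycong v (g j') (F i * R')"
    using F_dvd i j by metis
  define E where "E = smult c (\<Prod>k\<in>{..<s} - {j} - {j'}. g k)"
  have "f = g j * g j' * E"
    using j by (simp add: f_eq E_def prod.remove[of _ j] prod.remove[of _ j'] mult.assoc)
  also have "polycong v (g j * g j' * E) (F i * R * (F i * R') * E)"
    using R by (intro polycong_mult polycong_refl)
  finally have "polycong v f (F i * F i * (R * R' * E))"
    by (simp add: mult_ac)
  then obtain U where "polycong v (F i * U) 1" using sqf by blast
  then have "polycong v 1 0"
    using monic_multiple_cong_small[OF F_monic[OF ir]] F_deg[OF ir] by simp
  then have "v dvd 1"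
    by (auto simp: polycong_coeff dest: spec[of _ 0])
  with v_irr show False by auto
qed

text \<open>The blocks already account for the whole degree of \<open>f\<close>, and a local factor
  outside them would add a positive degree.\<close>

lemma B_cover: "(\<Union>j<s. B j) = {..<r}"
proof (rule ccontr)
  let ?U = "\<Union>j<s. B j"
  have sub: "?U \<subseteq> {..<r}" using B_sub by auto
  assume "?U \<noteq> {..<r}"
  with sub obtain i where i: "i < r" "i \<notin> ?U" by auto
  have "degree f = (\<Sum>j<s. degree (g j))"
    using g_nz c_nz by (simp add: f_eq degree_prod_eq_sum_degree)
  also have "\<dots> = (\<Sum>j<s. \<Sum>i\<in>B j. degree (F i))"
    by (simp add: degree_g)
  also have "\<dots> = (\<Sum>i\<in>?U. degree (F i))"
    using B_sub B_disjoint by (subst sum.UNION_disjoint) (auto intro: finite_subset)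
  also have "\<dots> < (\<Sum>i<r. degree (F i))"
    using sub i F_deg by (intro sum_strict_mono2[of _ _ i]) auto
  finally show False by (simp add: degree_f)
qed

section \<open>Combinations of the reduced polynomials Phi and their t-degree\<close>

lemma Phi_cong:
  "polycong (v ^ ell) (Phi j) (smult (lead_coeff f) (pderiv (F j) * (\<Prod>i\<in>{..<r} - {j}. F i)))"
  unfolding Phi_def by (rule polycong_redX)

lemma degree_coeff_Phi: "degree (coeff (Phi j) i) < ell * degree v"
proof -
  \<comment> \<open>Positivity covers the remainder 0, whose degree is 0.\<close>
  have "0 < degree (v ^ ell)"
    unfolding degree_modulus using degt_less by linarith
  then have "degree (a mod v ^ ell) < degree (v ^ ell)" for a
    using degree_mod_less'[of "v ^ ell" a] v_nz by (cases "a mod v ^ ell = 0") auto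
  then show ?thesis by (simp add: Phi_def degree_modulus)
qed

lemma degree_Phi:
  assumes "j < r"
  shows "degree (Phi j) < degree f"
proof -
  have "degree (Phi j) \<le> degree (pderiv (F j)) + (\<Sum>i\<in>{..<r} - {j}. degree (F i))"
    unfolding Phi_def degree_prod_F[of "{..<r} - {j}", OF Diff_subset, symmetric]
    by (rule order_trans[OF degree_redX_le order_trans[OF degree_smult_le degree_mult_le]])
  also have "\<dots> < degree (F j) + (\<Sum>i\<in>{..<r} - {j}. degree (F i))"
    using degree_pderiv_le[of "F j"] F_deg[OF assms] by simp
  also have "\<dots> = degree f"
    using assms by (simp add: degree_f sum.remove[of "{..<r}" j])
  finally show ?thesis .
qed

lemma coeff_coeff_comb: "coeff (coeff (comb x) i) k = (\<Sum>j<r. coeff (coeff (Phi j) i) k * x j)"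
  by (simp add: comb_def coeff_sum mult.commute)

lemma degree_comb: "degree (comb x) < degree f"
  unfolding comb_def using degree_Phi deg_f
  by (intro degree_sum_less) (auto intro: le_less_trans[OF degree_smult_le])

text \<open>The right side is the kernel condition for the matrices \<open>A_i\<close> over F_q.
  Coefficients outside its index ranges vanish anyway: \<open>comb x\<close> has X-degree below that
  of \<open>f\<close>, and its coefficients are sums of reduced residues.\<close>

lemma degt_comb_le_iff:
  "degt (comb x) \<le> degt f \<longleftrightarrow>
    (\<forall>i<degree f. \<forall>k\<in>{degt f + 1..<ell * degree v}. (\<Sum>j<r. coeff (coeff (Phi j) i) k * x j) = 0)"
proof
  assume *: "degt (comb x) \<le> degt f"
  show "\<forall>i<degree f. \<forall>k\<in>{degt f + 1..<ell * degree v}. (\<Sum>j<r. coeff (coeff (Phi j) i) k * x j) = 0"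
  proof (intro allI impI ballI)
    fix i k assume "k \<in> {degt f + 1..<ell * degree v}"
    then have "degree (coeff (comb x) i) < k"
      using * degree_coeff_le_degt[of "comb x" i] by simp
    then show "(\<Sum>j<r. coeff (coeff (Phi j) i) k * x j) = 0"
      by (simp add: coeff_eq_0 flip: coeff_coeff_comb)
  qed
next
  assume *: "\<forall>i<degree f. \<forall>k\<in>{degt f + 1..<ell * degree v}. (\<Sum>j<r. coeff (coeff (Phi j) i) k * x j) = 0"
  show "degt (comb x) \<le> degt f"
    unfolding degt_le_iff
  proof (intro allI degree_le impI)
    fix i k assume k: "degt f < k"
    consider "degree f \<le> i" | "ell * degree v \<le> k" | "i < degree f" "k < ell * degree v"
      by linarith
    then show "coeff (coeff (comb x) i) k = 0"
    proof cases
      case 1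
      then show ?thesis using degree_comb[of x] by (simp add: coeff_eq_0)
    next
      case 2
      then have "coeff (coeff (Phi j) i) k = 0" for j
        using degree_coeff_Phi[of j i] by (intro coeff_eq_0) simp
      then show ?thesis by (simp add: coeff_coeff_comb)
    next
      case 3
      then show ?thesis using * k by (simp add: coeff_coeff_comb)
    qed
  qed
qed

text \<open>The product rule. With \<open>Phi_cong\<close> it shows that the all-ones vector yields
  \<open>f'\<close> modulo \<open>v^ell\<close>.\<close>

lemma pderiv_f_cong:
  "polycong (v ^ ell) (pderiv f)
    (\<Sum>j<r. smult (lead_coeff f) (pderiv (F j) * (\<Prod>i\<in>{..<r} - {j}. F i)))"
proof -
  have "polycong (v ^ ell) (pderiv f) (pderiv (smult (lead_coeff f) (\<Prod>i<r. F i)))"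
    by (intro polycong_pderiv f_cong)
  then show ?thesis
    by (simp add: pderiv_smult pderiv_prod smult_sum2 mult.commute)
qed

text \<open>The sum of the \<open>\<Phi>(f\<^sub>i)\<close> over the local factors of \<open>g\<close> is \<open>f g' / g\<close>, a genuine polynomial of
  \<open>t\<close>-degree at most \<open>deg\<^sub>t f\<close>; it is hence not changed by the reduction.\<close>

lemma degt_sum_Phi:
  assumes j: "j < s"
  shows "degt (\<Sum>i\<in>B j. Phi i) \<le> degt f"
proof -
  define h where "h = smult c (\<Prod>k\<in>{..<s} - {j}. g k)"
  have f_gh: "f = g j * h"
    using j by (simp add: f_eq h_def prod.remove[of _ j])
  have h_nz: "h \<noteq> 0" using f_nz f_gh by auto
  have fin: "finite (B j)" using B_sub[OF j] finite_subset by blast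
  let ?b = "lead_coeff (g j)" and ?l = "lead_coeff f"
  let ?P = "\<Prod>i\<in>B j. F i" and ?Q = "\<Prod>i\<in>{..<r} - B j. F i"
  have PQ: "(\<Prod>i<r. F i) = ?P * ?Q"
    using prod.subset_diff[OF B_sub[OF j], of F] by (simp add: mult.commute)
  \<comment> \<open>Both products are congruent to \<open>f\<close>; cancelling the monic
    \<open>?P\<close> identifies the cofactor \<open>h\<close> with the remaining local factors, up
    to leading coefficients.\<close>
  have "polycong (v ^ ell) (?P * (smult ?b h - smult ?l ?Q)) 0"
  proof -
    have "polycong (v ^ ell) (smult ?b ?P * h) (g j * h)"
      by (intro polycong_mult polycong_refl polycong_sym[OF g_cong[OF j]])
    also have "g j * h = f" by (simp add: f_gh)
    also have "polycong (v ^ ell) f (smult ?l (?P * ?Q))"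
      using f_cong by (simp add: PQ)
    finally have "polycong (v ^ ell) (smult ?b ?P * h) (smult ?l (?P * ?Q))" .
    then show ?thesis by (simp add: polycong_def algebra_simps)
  qed
  then have "polycong (v ^ ell) (smult ?b h - smult ?l ?Q) 0"
    using lead_prod_F[OF B_sub[OF j]] by (intro monic_cancel_cong) auto
  then have h_cong: "polycong (v ^ ell) (smult ?b h) (smult ?l ?Q)"
    by (simp add: polycong_def)
  have "polycong (v ^ ell) (pderiv (g j) * h) (pderiv (smult ?b ?P) * h)"
    by (intro polycong_mult polycong_pderiv g_cong j polycong_refl)
  also have "pderiv (smult ?b ?P) * h = pderiv ?P * smult ?b h"
    by (simp add: pderiv_smult)
  also have "polycong (v ^ ell) (pderiv ?P * smult ?b h) (pderiv ?P * smult ?l ?Q)"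
    by (intro polycong_mult h_cong polycong_refl)
  also have "pderiv ?P * smult ?l ?Q
      = (\<Sum>i\<in>B j. smult ?l (pderiv (F i) * (\<Prod>k\<in>{..<r} - {i}. F k)))"
  proof -
    have "(\<Prod>k\<in>{..<r} - {i}. F k) = (\<Prod>k\<in>B j - {i}. F k) * ?Q" if "i \<in> B j" for i
    proof -
      have "{..<r} - {i} = (B j - {i}) \<union> ({..<r} - B j)"
        using that B_sub[OF j] by auto
      then show ?thesis
        by (simp only:) (rule prod.union_disjoint; use fin in auto)
    qed
    then have "(\<Prod>k\<in>B j - {i}. F k) * pderiv (F i) * smult ?l ?Q
        = smult ?l (pderiv (F i) * (\<Prod>k\<in>{..<r} - {i}. F k))" if "i \<in> B j" for i
      using that by (simp add: mult_ac)
    then show ?thesis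
      by (simp only: pderiv_prod sum_distrib_right) (rule sum.cong[OF refl])
  qed
  also have "polycong (v ^ ell) \<dots> (\<Sum>i\<in>B j. Phi i)"
    by (intro polycong_sum polycong_sym[OF Phi_cong])
  finally have cong: "polycong (v ^ ell) (\<Sum>i\<in>B j. Phi i) (pderiv (g j) * h)"
    by (rule polycong_sym)
  have "degt (pderiv (g j) * h) \<le> degt (g j) + degt h"
    by (rule order_trans[OF degt_mult_le]) (simp add: degt_pderiv_le)
  also have "\<dots> \<le> degt f"
    unfolding f_gh by (intro degt_mult_ge g_nz[OF j] h_nz)
  finally have degt: "degt (pderiv (g j) * h) \<le> degt f" .
  have "(\<Sum>i\<in>B j. Phi i) = pderiv (g j) * h"
  proof (rule small_cong_imp_eq[OF cong])
    fix k
    show "degree (coeff (\<Sum>i\<in>B j. Phi i) k) < ell * degree v"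
      unfolding coeff_sum using degt_less
      by (intro degree_sum_less degree_coeff_Phi) linarith+
    show "degree (coeff (pderiv (g j) * h) k) < ell * degree v"
      using degree_coeff_le_degt degt degt_less by (meson le_less_trans)
  qed
  with degt show ?thesis by simp
qed

text \<open>Modulo \<open>f\<^sub>i\<close> the combination is \<open>x\<^sub>i f'\<close>, so \<open>v\<^sup>\<ell>\<close> divides the resultant of \<open>g\<close> and
  \<open>\<Sum> x\<^sub>j \<Phi>(f\<^sub>j) - x\<^sub>i f'\<close>, whose degree is below that of \<open>v\<^sup>\<ell>\<close>.\<close>

lemma g_dvd_comb_diff:
  assumes j: "j < s" and i: "i \<in> B j" and x: "degt (comb x) \<le> degt f"
  shows "map_poly to_fract (g j) dvd map_poly to_fract (comb x - smult [:x i:] (pderiv f))"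
proof -
  define C where "C = comb x - smult [:x i:] (pderiv f)"
  have ir: "i < r" using B_sub[OF j] i by auto
  have fin: "finite (B j)" using B_sub[OF j] finite_subset by blast
  have deg_C: "degree C < degree f"
    using degree_comb[of x] degree_pderiv_le[of f] degree_smult_le[of "[:x i:]" "pderiv f"] deg_f
    by (auto simp: C_def intro!: degree_diff_less)
  have degt_C: "degt C \<le> degt f"
  proof -
    have "degree (coeff (smult [:x i:] (pderiv f)) k) \<le> degt f" for k
      using degree_coeff_le_degt[of "pderiv f" k] degt_pderiv_le[of f]
      by (auto intro: order_trans[OF degree_smult_le])
    then show ?thesis
      using x by (auto simp: C_def degt_le_iff intro!: degree_diff_le)
  qed
  let ?T = "\<lambda>k. smult (lead_coeff f) (pderiv (F k) * (\<Prod>l\<in>{..<r} - {k}. F l))"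
  \<comment> \<open>Subtracting \<open>x i\<close> times \<open>f'\<close> removes the term of index
    \<open>i\<close>, and every other term contains the factor \<open>F i\<close>.\<close>
  obtain C' where C': "polycong (v ^ ell) C (F i * C')"
  proof -
    have "polycong (v ^ ell) C ((\<Sum>k<r. smult [:x k:] (?T k)) - smult [:x i:] (\<Sum>k<r. ?T k))"
      unfolding C_def comb_def
      by (intro polycong_diff polycong_sum polycong_smult Phi_cong pderiv_f_cong)
    also have "(\<Sum>k<r. smult [:x k:] (?T k)) - smult [:x i:] (\<Sum>k<r. ?T k)
        = (\<Sum>k<r. smult [:x k - x i:] (?T k))"
      by (simp only: smult_sum2 sum_subtractf[symmetric] smult_diff_left[symmetric] diff_pCons diff_self)
    also have "\<dots> = (\<Sum>k\<in>{..<r} - {i}. smult [:x k - x i:] (?T k))"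
      using ir by (simp add: sum.remove[of _ i])
    also have "F i dvd \<dots>"
    proof (rule dvd_sum)
      fix k assume "k \<in> {..<r} - {i}"
      then have "F i dvd (\<Prod>l\<in>{..<r} - {k}. F l)"
        using ir by (intro dvd_prodI) auto
      then show "F i dvd smult [:x k - x i:] (?T k)"
        by (intro dvd_smult) simp
    qed
    then obtain C' where "(\<Sum>k\<in>{..<r} - {i}. smult [:x k - x i:] (?T k)) = F i * C'"
      by (elim dvdE)
    finally show ?thesis by (rule that)
  qed
  obtain g' where g': "polycong (v ^ ell) (g j) (F i * g')"
  proof -
    have "(\<Prod>i\<in>B j. F i) = F i * (\<Prod>i\<in>B j - {i}. F i)"
      using i fin by (simp add: prod.remove)
    with g_cong[OF j] show ?thesis
      using that[of "smult (lead_coeff (g j)) (\<Prod>i\<in>B j - {i}. F i)"] by simp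
  qed
  obtain M N where MN: "[:resultant (g j) C:] = M * g j + N * C"
    by (rule resultant_in_ideal[of "g j" C]) (use degree_g_pos[OF j] in auto)
  \<comment> \<open>Modulo \<open>v^ell\<close> the resultant is a constant multiple of the monic
    nonconstant \<open>F i\<close>, hence 0.\<close>
  have "polycong (v ^ ell) (M * g j + N * C) (M * (F i * g') + N * (F i * C'))"
    by (intro polycong_add polycong_mult polycong_refl g' C')
  also have "M * (F i * g') + N * (F i * C') = F i * (M * g' + N * C')"
    by (simp add: algebra_simps)
  finally have "polycong (v ^ ell) (F i * (M * g' + N * C')) [:resultant (g j) C:]"
    unfolding MN by (rule polycong_sym)
  then have "polycong (v ^ ell) [:resultant (g j) C:] 0"
    by (rule monic_multiple_cong_small[OF F_monic[OF ir]]) (use F_deg[OF ir] in simp)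
  then have "v ^ ell dvd resultant (g j) C"
    by (auto simp: polycong_coeff dest: spec[of _ 0])
  moreover have "degree (resultant (g j) C) < ell * degree v"
  proof -
    define h where "h = smult c (\<Prod>k\<in>{..<s} - {j}. g k)"
    have f_gh: "f = g j * h"
      using j by (simp add: f_eq h_def prod.remove[of _ j])
    have h_nz: "h \<noteq> 0" using f_nz f_gh by auto
    have "degt (g j) \<le> degt f"
      using degt_mult_ge[OF g_nz[OF j] h_nz] f_gh by simp
    moreover have "degree (g j) \<le> degree f"
      using degree_mult_eq[OF g_nz[OF j] h_nz] f_gh by simp
    \<comment> \<open>The constant 2n-1 arises here as the sum of the X-degree bounds n-1 for
      \<open>C\<close> and n for \<open>g j\<close>.\<close>
    ultimately have "degree C * degt (g j) + degree (g j) * degt C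
        \<le> (degree f - 1) * degt f + degree f * degt f"
      using deg_C degt_C by (intro add_mono mult_mono) auto
    also have "\<dots> = (2 * degree f - 1) * degt f"
    proof -
      have "degree f - 1 + degree f = 2 * degree f - 1" using deg_f by linarith
      then show ?thesis by (simp only: flip: add_mult_distrib)
    qed
    finally show ?thesis
      using degree_resultant_le[of "g j" C] big by linarith
  qed
  ultimately have "resultant (g j) C = 0"
    by (rule small_dvd_imp_zero)
  then show ?thesis
    unfolding C_def by (rule resultant_zero_irreducible_dvd) (rule g_irr[OF j])
qed

text \<open>Since \<open>g j\<close> divides \<open>f\<close>, it would be a nonunit common factor
  of \<open>f\<close> and \<open>f'\<close>.\<close>

lemma g_not_dvd_pderiv:
  assumes "j < s"
  shows "\<not> map_poly to_fract (g j) dvd map_poly to_fract (pderiv f)"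
proof
  interpret map_poly_inj_idom_hom "to_fract :: 'a poly \<Rightarrow> _" ..
  assume "map_poly to_fract (g j) dvd map_poly to_fract (pderiv f)"
  then have "map_poly to_fract (g j) dvd pderiv (map_poly to_fract f)"
    by (simp add: to_fract_hom.map_poly_pderiv)
  moreover have "g j dvd f"
    unfolding f_eq using assms by (intro dvd_smult dvd_prodI) auto
  then have "map_poly to_fract (g j) dvd map_poly to_fract f"
    by (rule hom_dvd)
  ultimately have "is_unit (map_poly to_fract (g j))"
    using sep unfolding separable_K_def by (meson coprime_common_divisor)
  with g_irr[OF assms] show False by auto
qed

lemma degt_comb_iff_const_on_blocks:
  "degt (comb x) \<le> degt f \<longleftrightarrow> (\<forall>j<s. \<forall>i\<in>B j. \<forall>i'\<in>B j. x i = x i')"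
proof
  assume x: "degt (comb x) \<le> degt f"
  show "\<forall>j<s. \<forall>i\<in>B j. \<forall>i'\<in>B j. x i = x i'"
  proof (intro allI impI ballI)
    interpret map_poly_inj_idom_hom "to_fract :: 'a poly \<Rightarrow> _" ..
    fix j i i' assume j: "j < s" and i: "i \<in> B j" "i' \<in> B j"
    let ?D = "\<lambda>i. map_poly to_fract (comb x - smult [:x i:] (pderiv f))"
    \<comment> \<open>The difference eliminates \<open>comb x\<close> and leaves a scalar multiple
      of \<open>f'\<close>.\<close>
    have "map_poly to_fract (g j) dvd ?D i' - ?D i"
      using g_dvd_comb_diff[OF j _ x] i by (intro dvd_diff) auto
    also have "?D i' - ?D i = map_poly to_fract (smult [:x i - x i':] (pderiv f))"
    proof -
      have "[:x i - x i':] = [:x i:] - [:x i':]" by simp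
      then show ?thesis
        by (simp add: hom_minus smult_diff_left del: diff_pCons)
    qed
    also have "\<dots> = smult (to_fract [:x i - x i':]) (map_poly to_fract (pderiv f))"
      by simp
    finally have dvd: "map_poly to_fract (g j) dvd \<dots>" .
    have "to_fract [:x i - x i':] = 0"
      using dvd_smult_cancel[OF dvd] g_not_dvd_pderiv[OF j] by blast
    then show "x i = x i'" by simp
  qed
next
  assume x: "\<forall>j<s. \<forall>i\<in>B j. \<forall>i'\<in>B j. x i = x i'"
  have "\<forall>j<s. \<exists>y. \<forall>i\<in>B j. x i = y" using x by blast
  then obtain y where y: "x i = y j" if "j < s" "i \<in> B j" for i j
    by metis
  \<comment> \<open>The blocks partition the indices, so the sum can be grouped and the common value
    taken out of each block.\<close>
  have "comb x = (\<Sum>j<s. \<Sum>i\<in>B j. smult [:x i:] (Phi i))"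
    unfolding comb_def B_cover[symmetric]
    using B_sub B_disjoint by (subst sum.UNION_disjoint) (auto intro: finite_subset)
  also have "\<dots> = (\<Sum>j<s. smult [:y j:] (\<Sum>i\<in>B j. Phi i))"
    unfolding smult_sum2 by (intro sum.cong refl) (simp add: y)
  finally have comb: "comb x = (\<Sum>j<s. smult [:y j:] (\<Sum>i\<in>B j. Phi i))" .
  have "degree (coeff (comb x) k) \<le> degt f" for k
  proof -
    have "degree (coeff (smult [:y j:] (\<Sum>i\<in>B j. Phi i)) k) \<le> degt f" if "j < s" for j
    proof -
      have "degree (coeff (smult [:y j:] (\<Sum>i\<in>B j. Phi i)) k) \<le> degree (coeff (\<Sum>i\<in>B j. Phi i) k)"
        by (simp add: degree_smult_le del: coeff_sum)
      also have "\<dots> \<le> degt f"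
        using degt_sum_Phi[OF that] degree_coeff_le_degt order_trans by blast
      finally show ?thesis .
    qed
    then show ?thesis
      unfolding comb coeff_sum[of _ "{..<s}"] by (intro degree_sum_le) auto
  qed
  then show "degt (comb x) \<le> degt f" by (simp add: degt_le_iff)
qed

text \<open>By disjointness only the block \<open>B j\<close> contains \<open>i\<close>; thus a
  combination of the generators of W has the value \<open>y j\<close> on \<open>B j\<close>.\<close>

lemma sum_block_indicator:
  fixes y :: "nat \<Rightarrow> 'a"
  assumes "j < s" "i \<in> B j"
  shows "(\<Sum>k<s. y k * (if i \<in> B k then 1 else 0)) = y j"
proof -
  have "y k * (if i \<in> B k then 1 else 0) = (if k = j then y j else 0)" if "k < s" for k
    using assms B_disjoint[OF that assms(1)] by auto
  then have "(\<Sum>k<s. y k * (if i \<in> B k then 1 else 0)) = (\<Sum>k<s. if k = j then y j else 0)"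
    by (intro sum.cong) auto
  then show ?thesis using assms(1) by simp
qed

end

section \<open>Linear algebra over the prime field\<close>

lemma Fp_0: "0 \<in> Fp"
  unfolding Fp_def by (metis of_nat_0 rangeI)

lemma Fp_1: "1 \<in> Fp"
  unfolding Fp_def by (metis of_nat_1 rangeI)

lemma Fp_add: "a \<in> Fp \<Longrightarrow> b \<in> Fp \<Longrightarrow> a + b \<in> Fp"
  by (auto simp: Fp_def simp flip: of_nat_add)

lemma Fp_mult: "a \<in> Fp \<Longrightarrow> b \<in> Fp \<Longrightarrow> a * b \<in> Fp"
  by (auto simp: Fp_def simp flip: of_nat_mult)

lemma Fp_sum: "(\<And>i. i \<in> A \<Longrightarrow> h i \<in> Fp) \<Longrightarrow> (\<Sum>i\<in>A. h i) \<in> Fp"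
  by (induction A rule: infinite_finite_induct) (auto intro: Fp_0 Fp_add)

lemma psi_spec:
  assumes "is_Fp_basis \<gamma> w"
  shows "psi \<gamma> w c l \<in> Fp" "l \<ge> w \<Longrightarrow> psi \<gamma> w c l = 0" "c = (\<Sum>l<w. psi \<gamma> w c l * \<gamma> l)"
proof -
  have "\<exists>!cs. (\<forall>l. cs l \<in> Fp) \<and> (\<forall>l\<ge>w. cs l = 0) \<and> c = (\<Sum>l<w. cs l * \<gamma> l)"
    using assms unfolding is_Fp_basis_def by blast
  from theI'[OF this, folded psi_def]
  show "psi \<gamma> w c l \<in> Fp" "l \<ge> w \<Longrightarrow> psi \<gamma> w c l = 0" "c = (\<Sum>l<w. psi \<gamma> w c l * \<gamma> l)"
    by blast+
qed

text \<open>For \<open>x\<close> over the prime field the sums on the left are the basis coordinates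
  of the sum on the right, and coordinates of 0 are unique. Passing from \<open>A_i\<close> to its
  expansion thus keeps the same F_p-vectors in the kernel.\<close>

lemma psi_combination_zero_iff:
  assumes basis: "is_Fp_basis \<gamma> w" and x: "\<And>j. x j \<in> Fp"
  shows "(\<forall>l<w. (\<Sum>j<r. psi \<gamma> w (a j) l * x j) = 0) \<longleftrightarrow> (\<Sum>j<r. a j * x j) = 0"
proof -
  define cs where "cs l = (\<Sum>j<r. psi \<gamma> w (a j) l * x j)" for l
  have cs: "\<forall>l. cs l \<in> Fp" "\<forall>l\<ge>w. cs l = 0"
    unfolding cs_def using psi_spec(1,2)[OF basis] x by (auto intro!: Fp_sum Fp_mult)
  have "(\<Sum>j<r. a j * x j) = (\<Sum>j<r. \<Sum>l<w. psi \<gamma> w (a j) l * \<gamma> l * x j)"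
    by (subst psi_spec(3)[OF basis]) (simp add: sum_distrib_right)
  also have "\<dots> = (\<Sum>l<w. cs l * \<gamma> l)"
    unfolding cs_def by (subst sum.swap) (simp add: sum_distrib_left mult_ac)
  finally have eq: "(\<Sum>j<r. a j * x j) = (\<Sum>l<w. cs l * \<gamma> l)" .
  have "cs l = 0" if "(\<Sum>l<w. cs l * \<gamma> l) = 0" for l
  proof -
    let ?P = "\<lambda>cs. (\<forall>l. cs l \<in> Fp) \<and> (\<forall>l\<ge>w. cs l = 0) \<and> 0 = (\<Sum>l<w. cs l * \<gamma> l)"
    have unique: "\<exists>!cs. ?P cs"
      using basis unfolding is_Fp_basis_def by blast
    have "cs = (THE cs. ?P cs)"
      by (rule the1_equality[OF unique, symmetric]) (use cs that in simp)
    also have "\<dots> = (\<lambda>l. 0)"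
      by (rule the1_equality[OF unique]) (simp add: Fp_0)
    finally show ?thesis by simp
  qed
  then show ?thesis
    unfolding eq cs_def[symmetric] by auto
qed

section \<open>Kernel and span, both described as the vectors constant on blocks\<close>

theorem theorem5p2:
  fixes p w :: nat and \<gamma> :: "nat \<Rightarrow> 'a::{field,finite}"
    and f :: "'a poly poly" and v :: "'a poly" and ell r s :: nat
    and F :: "nat \<Rightarrow> nat \<Rightarrow> 'a poly poly"
    and G :: "nat \<Rightarrow> 'a poly fract poly"
    and wm :: "nat \<Rightarrow> nat \<Rightarrow> bool"
  assumes p_prime: "prime p" and char_p: "of_nat p = (0::'a)" and q_def: "card (UNIV :: 'a set) = p ^ w"
    and basis: "is_Fp_basis \<gamma> w"
    and sep: "separable_K f" and n_ge: "degree f \<ge> 2"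
    and v_irr: "irreducible v" and v_lead: "\<not> v dvd lead_coeff f"
    and sqf: "squarefree_mod v f"
    and F_elem: "\<forall>i<r. OvX_elem v (F i) \<and> OvX_monic v (F i) \<and> OvX_irreducible v (F i)"
    and F_fact: "\<forall>k. embX v f k = redX v k (smult (lead_coeff f) (\<Prod>i<r. F i k))"
    and G_irr: "\<forall>j<s. lead_coeff (G j) = 1 \<and> irreducible (G j)"
    and G_fact: "map_poly to_fract f = smult (to_fract (lead_coeff f)) (\<Prod>j<s. G j)"
    and G_F: "\<forall>j<s. \<forall>k. vredX v k (G j) = redX v k (\<Prod>i\<in>{i. i < r \<and> wm j i}. F i k)"
    and ell_pos: "ell \<ge> 1"
    and big: "ell * degree v > (2 * degree f - 1) * degt f"
  shows "{x. (\<forall>j. x j \<in> Fp) \<and> (\<forall>j\<ge>r. x j = 0) \<and>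
             (\<forall>i<degree f. \<forall>c\<in>{degt f + 1..<ell * degree v}. \<forall>l<w.
                (\<Sum>j<r. psi \<gamma> w (coeff (coeff (PhiOv v f (F j) ell) i) c) l * x j) = 0)}
       = {x. \<exists>cs. (\<forall>j. cs j \<in> Fp) \<and>
             x = (\<lambda>i. if i < r then (\<Sum>j<s. cs j * (if wm j i then 1 else 0)) else 0)}"
proof -
  have "f \<noteq> 0" using n_ge by auto
  then have "\<exists>c g. f = smult c (\<Prod>j<s. g j) \<and>
      (\<forall>j<s. map_poly to_fract (g j) = smult (to_fract (lead_coeff (g j))) (G j))"
    by (rule monic_factors_lift[OF _ _ G_fact]) (use G_irr in blast)+
  then obtain c g where f_eq: "f = smult c (\<Prod>j<s. g j)"
    and g: "\<And>j. j < s \<Longrightarrow> map_poly to_fract (g j) = smult (to_fract (lead_coeff (g j))) (G j)"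
    by blast
  define B where "B j = {i. i < r \<and> wm j i}" for j
  interpret local_global_factorization v ell r s f "\<lambda>i. F i ell" g B c
  proof unfold_locales
    show "lead_coeff (F i ell) = 1" "0 < degree (F i ell)" if "i < r" for i
      using OvX_irreducible_monic_degree_pos[of v "F i" ell] F_elem that ell_pos by auto
    show "polycong (v ^ ell) f (smult (lead_coeff f) (\<Prod>i<r. F i ell))"
      using F_fact by (simp add: embX_def redX_eq_iff)
    show "\<exists>U. polycong v (Q * U) 1" if "polycong v f (Q * Q * R)" for Q R
    proof -
      have "redX v 1 f = redX v 1 (Q * Q * R)"
        using that by (simp add: redX_eq_iff)
      then obtain U where "redX v 1 (Q * U) = 1"
        using sqf unfolding squarefree_mod_def by blast
      then show ?thesis
        using polycong_sym[OF polycong_redX[of v 1 "Q * U"]] by auto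
    qed
    show "B j \<subseteq> {..<r}" for j
      by (auto simp: B_def)
    fix j assume j: "j < s"
    have lead: "\<not> v dvd lead_coeff (g j)"
      by (rule not_dvd_lead_coeff_factor[OF f_eq v_lead j])
    \<comment> \<open>The given congruence for the monic \<open>G j\<close> is moved to
      \<open>g j\<close> by clearing the denominator \<open>lead_coeff (g j)\<close>, which is prime
      to \<open>v\<close>.\<close>
    have "polycong (v ^ ell) (g j) (smult (lead_coeff (g j)) (redX v ell (\<Prod>i\<in>B j. F i ell)))"
      using vredX_cong[OF v_irr lead g[OF j], of ell] G_F j by (simp add: B_def)
    also have "polycong (v ^ ell) \<dots> (smult (lead_coeff (g j)) (\<Prod>i\<in>B j. F i ell))"
      by (intro polycong_smult polycong_redX)
    finally show "polycong (v ^ ell) (g j) (smult (lead_coeff (g j)) (\<Prod>i\<in>B j. F i ell))" .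
    have "lead_coeff (g j) \<noteq> 0" using lead by auto
    then show "irreducible (map_poly to_fract (g j))"
      unfolding g[OF j] using G_irr j by simp
  qed (use assms f_eq in auto)
  \<comment> \<open>The basis coordinates collapse to equations over F_q, which together say
    \<open>degt (comb x) \<le> degt f\<close>.\<close>
  have kernel_iff: "(\<forall>i<degree f. \<forall>c\<in>{degt f + 1..<ell * degree v}. \<forall>l<w.
        (\<Sum>j<r. psi \<gamma> w (coeff (coeff (PhiOv v f (F j) ell) i) c) l * x j) = 0)
      \<longleftrightarrow> (\<forall>j<s. \<forall>i\<in>B j. \<forall>i'\<in>B j. x i = x i')" if x: "\<forall>j. x j \<in> Fp" for x
  proof -
    have "PhiOv v f (F j) ell = Phi j" if "j < r" for j
      unfolding Phi_def using F_elem F_fact that by (intro PhiOv_eq) auto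
    then have "(\<Sum>j<r. psi \<gamma> w (coeff (coeff (PhiOv v f (F j) ell) i) k) l * x j)
        = (\<Sum>j<r. psi \<gamma> w (coeff (coeff (Phi j) i) k) l * x j)" for i k l
      by (intro sum.cong) auto
    then show ?thesis
      unfolding degt_comb_iff_const_on_blocks[symmetric] degt_comb_le_iff
      using psi_combination_zero_iff[OF basis, of x] x by simp
  qed
  have const_iff: "(\<forall>j. x j \<in> Fp) \<and> (\<forall>j\<ge>r. x j = 0) \<and> (\<forall>j<s. \<forall>i\<in>B j. \<forall>i'\<in>B j. x i = x i')
      \<longleftrightarrow> (\<exists>cs. (\<forall>j. cs j \<in> Fp) \<and>
             x = (\<lambda>i. if i < r then (\<Sum>j<s. cs j * (if wm j i then 1 else 0)) else 0))" for x :: "nat \<Rightarrow> 'a"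
  proof (intro iffI)
    assume x: "(\<forall>j. x j \<in> Fp) \<and> (\<forall>j\<ge>r. x j = 0) \<and> (\<forall>j<s. \<forall>i\<in>B j. \<forall>i'\<in>B j. x i = x i')"
    \<comment> \<open>Any member of the block gives its constant value. On an empty block the choice
      is arbitrary, but \<open>cs j\<close> still lies in \<open>Fp\<close> because all values of
      \<open>x\<close> do.\<close>
    define cs where "cs j = x (SOME i. i \<in> B j)" for j
    have "x i = (\<Sum>j<s. cs j * (if wm j i then 1 else 0))" if i: "i < r" for i
    proof -
      obtain j where j: "j < s" "i \<in> B j" using B_cover i by blast
      then have "cs j = x i"
        unfolding cs_def using x someI[of "\<lambda>i. i \<in> B j" i] by blast
      with sum_block_indicator[OF j, of cs] i show ?thesis
        by (simp add: B_def)
    qed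
    with x have "x = (\<lambda>i. if i < r then (\<Sum>j<s. cs j * (if wm j i then 1 else 0)) else 0)"
      by (auto simp: fun_eq_iff)
    moreover have "\<forall>j. cs j \<in> Fp" using x by (simp add: cs_def)
    ultimately show "\<exists>cs. (\<forall>j. cs j \<in> Fp) \<and>
        x = (\<lambda>i. if i < r then (\<Sum>j<s. cs j * (if wm j i then 1 else 0)) else 0)"
      by blast
  next
    assume "\<exists>cs. (\<forall>j. cs j \<in> Fp) \<and>
        x = (\<lambda>i. if i < r then (\<Sum>j<s. cs j * (if wm j i then 1 else 0)) else 0)"
    then obtain cs where cs: "\<forall>j. cs j \<in> Fp"
      and x: "x = (\<lambda>i. if i < r then (\<Sum>j<s. cs j * (if wm j i then 1 else 0)) else 0)"
      by blast
    have "x i = cs j" if j: "j < s" "i \<in> B j" for i j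
      using sum_block_indicator[OF j, of cs] that by (simp add: x B_def)
    moreover have "\<forall>j. x j \<in> Fp"
      unfolding x using cs by (auto intro!: Fp_sum Fp_mult Fp_0 Fp_1)
    ultimately show "(\<forall>j. x j \<in> Fp) \<and> (\<forall>j\<ge>r. x j = 0) \<and> (\<forall>j<s. \<forall>i\<in>B j. \<forall>i'\<in>B j. x i = x i')"
      using x by simp
  qed
  show ?thesis
    unfolding const_iff[symmetric]
    by (intro Collect_cong conj_cong refl kernel_iff)
qed

end
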